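(* The ordinary and exponential generating functions for the $k$-Mersenne-Lucas octonions are given, respectively, by 1. $\displaystyle\sum_{n=0}^{\infty}m\mathbb{O}_{k,n}x^n=\frac{m\mathbb{O}_{k,0}+x\left(m\mathbb{O}_{k,1}-3km\mathbb{O}_{k,0}\right)}{1-3kx+2x^2}$; 2. $\displaystyle\sum_{n=0}^{\infty}\frac{m\mathbb{O}_{k,n}x^n}{n!}=\alpha e^{\lambda_1x}+\beta e^{\lambda_2x}$, where $\alpha=\sum_{r=0}^{7}\lambda_1^{r}e_r$ and $\beta=\sum_{r=0}^{7}\lambda_2^{r}e_r$.
   Context: $\mathbb{O}$ denotes the octonions, the $8$-dimensional real algebra with basis $e_0=1,e_1,\dots,e_7$ (only its vector space structure is needed here). For a parameter $k$, the $k$-Mersenne-Lucas numbers are defined by $m_{k,0}=2$, $m_{k,1}=3k$, $m_{k,n+1}=3km_{k,n}-2m_{k,n-1}$ for $n\ge1$. The $n$-th $k$-Mersenne-Lucas octonion is $m\mathbb{O}_{k,n}=\sum_{r=0}^{7}m_{k,n+r}e_r$ for $n\ge 0$. The numbers $\lambda_1=\frac{3k+\sqrt{9k^2-8}}{2}$ and $\lambda_2=\frac{3k-\sqrt{9k^2-8}}{2}$ are the roots of $\lambda^2-3k\lambda+2=0$. *)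

theory Defs
  imports
    "HOL-Analysis.Analysis"
    "HOL-Computational_Algebra.Formal_Power_Series"
begin

text \<open>
  Only the vector space underlying the octonions is used, so an octonion is its vector of
  coordinates with respect to the basis \<open>e\<^sub>0, \<dots>, e\<^sub>7\<close>. The scalars are a type parameter:
  \<open>real octonion\<close> is the space of octonions, \<open>complex octonion\<close> its complexification, and
  \<open>real fps octonion\<close> the module of power series with octonion coefficients, written as
  octonions over the ring of power series.
\<close>

type_synonym 'a octonion = "'a ^ 8"

text \<open>The index type \<open>8\<close> consists of the residues modulo 8, so \<open>of_nat\<close> is a bijection from
  \<open>{0..7}\<close> onto it.\<close>

definition oct_basis :: "nat \<Rightarrow> 'a::{zero,one} octonion" where
  "oct_basis r = axis (of_nat r) 1"

fun mersenne_lucas :: "real \<Rightarrow> nat \<Rightarrow> real" where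
  "mersenne_lucas k 0 = 2"
| "mersenne_lucas k (Suc 0) = 3 * k"
| "mersenne_lucas k (Suc (Suc n)) = 3 * k * mersenne_lucas k (Suc n) - 2 * mersenne_lucas k n"

definition mersenne_lucas_oct :: "real \<Rightarrow> nat \<Rightarrow> real octonion" where
  "mersenne_lucas_oct k n = (\<Sum>r = 0..7. mersenne_lucas k (n + r) *s oct_basis r)"

text \<open>The octonion \<open>\<Sum>r. \<lambda>\<^sup>r e\<^sub>r\<close>; it is \<open>\<alpha>\<close> for \<open>\<lambda> = \<lambda>\<^sub>1\<close> and \<open>\<beta>\<close> for \<open>\<lambda> = \<lambda>\<^sub>2\<close>.\<close>

definition power_oct :: "'a::comm_ring_1 \<Rightarrow> 'a octonion" where
  "power_oct l = (\<Sum>r = 0..7. (l ^ r) *s oct_basis r)"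

text \<open>The real roots are meaningful only for \<open>9 * k\<^sup>2 \<ge> 8\<close>, because \<open>sqrt\<close> is an odd function
  on the reals; the complex roots are the correct ones for every real \<open>k\<close>.\<close>

definition lambda1 :: "real \<Rightarrow> real" where
  "lambda1 k = (3 * k + sqrt (9 * k\<^sup>2 - 8)) / 2"

definition lambda2 :: "real \<Rightarrow> real" where
  "lambda2 k = (3 * k - sqrt (9 * k\<^sup>2 - 8)) / 2"

definition clambda1 :: "real \<Rightarrow> complex" where
  "clambda1 k = (3 * complex_of_real k + csqrt (9 * (complex_of_real k)\<^sup>2 - 8)) / 2"

definition clambda2 :: "real \<Rightarrow> complex" where
  "clambda2 k = (3 * complex_of_real k - csqrt (9 * (complex_of_real k)\<^sup>2 - 8)) / 2"

definition complexify_oct :: "real octonion \<Rightarrow> complex octonion" where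
  "complexify_oct v = (\<chi> i. complex_of_real (v $ i))"

text \<open>The formal power series \<open>\<Sum>n. a n X\<^sup>n\<close> with octonion coefficients.\<close>

definition oct_fps :: "(nat \<Rightarrow> 'a octonion) \<Rightarrow> 'a fps octonion" where
  "oct_fps a = (\<chi> i. Abs_fps (\<lambda>n. a n $ i))"

definition oct_fps_const :: "'a::zero octonion \<Rightarrow> 'a fps octonion" where
  "oct_fps_const v = (\<chi> i. fps_const (v $ i))"

end

theory Submission
  imports Defs
begin

text \<open>
  Every claim can be read coordinate by coordinate, and each coordinate of \<open>n \<mapsto> m\<bbbO>\<^sub>k\<^sub>,\<^sub>n\<close> is a scalar sequence governed by
  the recurrence \<open>a (n + 2) = 3 k a (n + 1) - 2 a n\<close>.

  Two descriptions of that sequence are enough. The recurrence says that the product of the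
  generating series with \<open>1 - 3 k X + 2 X\<^sup>2\<close> has no terms of degree above one, which is the formal
  ordinary generating function. Binet's formula \<open>m\<bbbO>\<^sub>k\<^sub>,\<^sub>n = \<lambda>\<^sub>1\<^sup>n \<alpha> + \<lambda>\<^sub>2\<^sup>n \<beta>\<close>
  (\<open>mersenne_lucas_oct_binet\<close>) turns the exponential generating function into a sum of two
  exponential series, and the convergent ordinary one into a sum of two geometric series, whose
  ratios \<open>\<lambda>\<^sub>1 x\<close> and \<open>\<lambda>\<^sub>2 x\<close> have norm below one by assumption.

  Binet's formula follows from \<open>\<lambda>\<^sub>1 + \<lambda>\<^sub>2 = 3 k\<close> and \<open>\<lambda>\<^sub>1 \<lambda>\<^sub>2 = 2\<close> alone, even for a double
  root, because the initial values are \<open>2 = \<lambda>\<^sub>1\<^sup>0 + \<lambda>\<^sub>2\<^sup>0\<close> and \<open>3 k = \<lambda>\<^sub>1 + \<lambda>\<^sub>2\<close>. It is therefore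
  stated for roots in any commutative algebra over the reals, which covers the real and
  the complex roots at once.
\<close>

lemma mersenne_lucas_oct_nth:
  "mersenne_lucas_oct k n $ i = (\<Sum>r = 0..7. mersenne_lucas k (n + r) * oct_basis r $ i)"
  by (simp add: mersenne_lucas_oct_def)

lemma power_oct_nth: "power_oct l $ i = (\<Sum>r = 0..7. l ^ r * oct_basis r $ i)"
  by (simp add: power_oct_def)

lemma of_real_oct_basis_nth:
  "(of_real (oct_basis r $ i) :: 'a::real_algebra_1) = oct_basis r $ i"
  by (simp add: oct_basis_def axis_def)

lemma mersenne_lucas_oct_rec:
  "mersenne_lucas_oct k (Suc (Suc n)) $ i =
     3 * k * mersenne_lucas_oct k (Suc n) $ i - 2 * mersenne_lucas_oct k n $ i"
  by (simp add: mersenne_lucas_oct_nth sum_distrib_left sum_subtractf[symmetric] algebra_simps)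

lemma mersenne_lucas_binet:
  fixes l1 l2 :: "'a::{real_algebra_1, comm_ring_1}"
  assumes sum: "l1 + l2 = of_real (3 * k)" and prod: "l1 * l2 = 2"
  shows "of_real (mersenne_lucas k n) = l1 ^ n + l2 ^ n"
proof (induction n rule: induct_nat_012)
  case (ge2 n)
  have "of_real (mersenne_lucas k (Suc (Suc n))) =
      (l1 + l2) * (l1 ^ Suc n + l2 ^ Suc n) - (l1 * l2) * (l1 ^ n + l2 ^ n)"
    using ge2 by (simp only: mersenne_lucas.simps of_real_diff of_real_mult sum prod of_real_numeral)
  then show ?case
    by (simp add: algebra_simps)
qed (use sum in simp_all)

text \<open>Shifting the index by \<open>r\<close> multiplies each of the two powers by \<open>\<lambda>\<^sup>r\<close>, so that summing
  over the basis collects \<open>\<alpha>\<close> and \<open>\<beta>\<close>.\<close>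

lemma mersenne_lucas_oct_binet:
  fixes l1 l2 :: "'a::{real_algebra_1, comm_ring_1}"
  assumes "l1 + l2 = of_real (3 * k)" and "l1 * l2 = 2"
  shows "of_real (mersenne_lucas_oct k n $ i) =
    l1 ^ n * power_oct l1 $ i + l2 ^ n * power_oct l2 $ i"
  by (simp add: mersenne_lucas_oct_nth power_oct_nth mersenne_lucas_binet[OF assms]
      of_real_oct_basis_nth sum_distrib_left sum.distrib[symmetric] power_add algebra_simps)

lemma lambda_sum_prod:
  assumes "9 * k\<^sup>2 \<ge> 8"
  shows "lambda1 k + lambda2 k = 3 * k" "lambda1 k * lambda2 k = 2"
proof -
  have "(sqrt (9 * k\<^sup>2 - 8))\<^sup>2 = 9 * k\<^sup>2 - 8"
    using assms by simp
  then show "lambda1 k + lambda2 k = 3 * k" "lambda1 k * lambda2 k = 2"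
    by (auto simp: lambda1_def lambda2_def field_simps power2_eq_square)
qed

lemma clambda_sum_prod:
  "clambda1 k + clambda2 k = of_real (3 * k)" "clambda1 k * clambda2 k = 2"
proof -
  have "(csqrt (9 * (complex_of_real k)\<^sup>2 - 8))\<^sup>2 = 9 * (complex_of_real k)\<^sup>2 - 8"
    by simp
  then show "clambda1 k + clambda2 k = of_real (3 * k)" "clambda1 k * clambda2 k = 2"
    by (auto simp: clambda1_def clambda2_def field_simps power2_eq_square)
qed

text \<open>The product with the reversed characteristic polynomial vanishes from degree two on,
  since its coefficient of degree \<open>n + 2\<close> is \<open>a (n + 2) - p a (n + 1) + q a n\<close>. This polynomial
  has constant term \<open>1\<close> and hence is a unit among the power series.\<close>

lemma fps_linear_recurrence:
  fixes a :: "nat \<Rightarrow> 'a::field"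
  assumes "\<And>n. a (Suc (Suc n)) = p * a (Suc n) - q * a n"
  shows "Abs_fps a = (1 / (1 - fps_const p * fps_X + fps_const q * fps_X\<^sup>2)) *
    (fps_const (a 0) + fps_X * fps_const (a 1 - p * a 0))"
proof -
  let ?Q = "1 - fps_const p * fps_X + fps_const q * fps_X\<^sup>2"
  have Q: "fps_nth ?Q 0 \<noteq> 0"
    by (simp add: power2_eq_square)
  have "Abs_fps a * ?Q =
      Abs_fps a - fps_const p * (fps_X * Abs_fps a) + fps_const q * (fps_X * (fps_X * Abs_fps a))"
    by (simp add: algebra_simps power2_eq_square)
  also have "\<dots> = fps_const (a 0) + fps_X * fps_const (a 1 - p * a 0)"
  proof (rule fps_ext)
    fix n
    show "fps_nth (Abs_fps a - fps_const p * (fps_X * Abs_fps a) +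
        fps_const q * (fps_X * (fps_X * Abs_fps a))) n =
      fps_nth (fps_const (a 0) + fps_X * fps_const (a 1 - p * a 0)) n"
      by (cases n; cases "n - 1") (auto simp: assms)
  qed
  finally have main: "Abs_fps a * ?Q = fps_const (a 0) + fps_X * fps_const (a 1 - p * a 0)" .
  have "Abs_fps a = inverse ?Q * (Abs_fps a * ?Q)"
    using inverse_mult_eq_1[OF Q] by (metis mult.left_commute mult.right_neutral)
  also have "inverse ?Q = 1 / ?Q"
    using fps_divide_unit[OF Q, of 1] by simp
  finally show ?thesis
    unfolding main .
qed

lemma sums_vecI:
  fixes f :: "nat \<Rightarrow> 'a::real_normed_vector ^ 'n"
  assumes "\<And>i. (\<lambda>n. f n $ i) sums (s $ i)"
  shows "f sums s"
  using assms unfolding sums_def by (intro vec_tendstoI) simp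

text \<open>Over a common denominator, \<open>A / (1 - l\<^sub>1 x) + B / (1 - l\<^sub>2 x)\<close> has the numerator
  \<open>(A + B) - (l\<^sub>2 A + l\<^sub>1 B) x\<close>, in which \<open>A + B = a 0\<close> and
  \<open>- (l\<^sub>2 A + l\<^sub>1 B) = a 1 - (l\<^sub>1 + l\<^sub>2) a 0\<close>.\<close>

lemma sums_two_geometric:
  fixes l1 l2 x A B :: "'a::real_normed_field"
  assumes "norm (l1 * x) < 1" "norm (l2 * x) < 1"
    and a: "\<And>n. a n = l1 ^ n * A + l2 ^ n * B"
  shows "(\<lambda>n. x ^ n * a n) sums
    ((a 0 + x * (a 1 - (l1 + l2) * a 0)) / (1 - (l1 + l2) * x + l1 * l2 * x\<^sup>2))"
proof -
  have ne: "1 - l1 * x \<noteq> 0" "1 - l2 * x \<noteq> 0"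
    using assms(1,2) by auto
  have "(\<lambda>n. A * (l1 * x) ^ n + B * (l2 * x) ^ n) sums
      (A * (1 / (1 - l1 * x)) + B * (1 / (1 - l2 * x)))"
    using assms(1,2) by (intro sums_add sums_mult geometric_sums)
  also have "(\<lambda>n. A * (l1 * x) ^ n + B * (l2 * x) ^ n) = (\<lambda>n. x ^ n * a n)"
    by (simp add: a fun_eq_iff power_mult_distrib algebra_simps)
  also have "A * (1 / (1 - l1 * x)) + B * (1 / (1 - l2 * x)) =
      (A * (1 - l2 * x) + B * (1 - l1 * x)) / ((1 - l1 * x) * (1 - l2 * x))"
    using ne by (simp add: add_frac_eq)
  also have "A * (1 - l2 * x) + B * (1 - l1 * x) = a 0 + x * (a 1 - (l1 + l2) * a 0)"
    by (simp add: a algebra_simps)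
  also have "(1 - l1 * x) * (1 - l2 * x) = 1 - (l1 + l2) * x + l1 * l2 * x\<^sup>2"
    by (simp add: algebra_simps power2_eq_square)
  finally show ?thesis .
qed

text \<open>The weights \<open>1 / n!\<close> turn each power sequence \<open>l\<^sup>n\<close> into an exponential series.\<close>

lemma oct_exponential_generating_function:
  fixes v :: "nat \<Rightarrow> 'a::{real_normed_field, banach} octonion"
  assumes "\<And>n i. v n $ i = l1 ^ n * A $ i + l2 ^ n * B $ i"
  shows "oct_fps (\<lambda>n. (1 / fact n) *s v n) =
      fps_exp l1 *s oct_fps_const A + fps_exp l2 *s oct_fps_const B"
    and "(\<lambda>n. (x ^ n / fact n) *s v n) sums (exp (l1 * x) *s A + exp (l2 * x) *s B)"
proof -
  show "oct_fps (\<lambda>n. (1 / fact n) *s v n) =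
      fps_exp l1 *s oct_fps_const A + fps_exp l2 *s oct_fps_const B"
    by (simp add: vec_eq_iff fps_eq_iff oct_fps_def oct_fps_const_def assms field_simps)
  have exp_sums: "(\<lambda>n. (l * x) ^ n / fact n) sums exp (l * x)" for l :: 'a
    using exp_converges[of "l * x"] by (simp add: scaleR_conv_of_real divide_inverse mult.commute)
  show "(\<lambda>n. (x ^ n / fact n) *s v n) sums (exp (l1 * x) *s A + exp (l2 * x) *s B)"
  proof (rule sums_vecI)
    fix i
    have "(\<lambda>n. (l1 * x) ^ n / fact n * A $ i + (l2 * x) ^ n / fact n * B $ i) sums
        (exp (l1 * x) * A $ i + exp (l2 * x) * B $ i)"
      by (intro sums_add sums_mult2 exp_sums)
    then show "(\<lambda>n. ((x ^ n / fact n) *s v n) $ i) sums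
        (exp (l1 * x) *s A + exp (l2 * x) *s B) $ i"
      by (simp add: assms power_mult_distrib field_simps)
  qed
qed

lemma mersenne_lucas_oct_ordinary_fps:
  "oct_fps (mersenne_lucas_oct k) =
     (1 / (1 - fps_const (3 * k) * fps_X + 2 * fps_X\<^sup>2)) *s
       (oct_fps_const (mersenne_lucas_oct k 0) +
        fps_X *s oct_fps_const (mersenne_lucas_oct k 1 - (3 * k) *s mersenne_lucas_oct k 0))"
proof -
  have "Abs_fps (\<lambda>n. mersenne_lucas_oct k n $ i) =
      (1 / (1 - fps_const (3 * k) * fps_X + 2 * fps_X\<^sup>2)) *
        (fps_const (mersenne_lucas_oct k 0 $ i) +
         fps_X * fps_const (mersenne_lucas_oct k 1 $ i - 3 * k * mersenne_lucas_oct k 0 $ i))" for i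
    using fps_linear_recurrence[of "\<lambda>n. mersenne_lucas_oct k n $ i" "3 * k" 2,
        OF mersenne_lucas_oct_rec]
    by (simp only: numeral_fps_const)
  then show ?thesis
    unfolding vec_eq_iff oct_fps_def oct_fps_const_def
    by (simp add: distrib_left mult.assoc)
qed

text \<open>The two geometric series live over the complex numbers, because the roots need not be real;
  the result descends to the reals since all terms and the claimed sum are real.\<close>

lemma mersenne_lucas_oct_ordinary_sums:
  fixes x :: real
  assumes "norm (clambda1 k * complex_of_real x) < 1" "norm (clambda2 k * complex_of_real x) < 1"
  shows "(\<lambda>n. (x ^ n) *s mersenne_lucas_oct k n) sums
    ((1 / (1 - 3 * k * x + 2 * x\<^sup>2)) *s
      (mersenne_lucas_oct k 0 +
       x *s (mersenne_lucas_oct k 1 - (3 * k) *s mersenne_lucas_oct k 0)))"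
proof (rule sums_vecI)
  fix i
  let ?a = "\<lambda>n. mersenne_lucas_oct k n $ i"
  have "(\<lambda>n. complex_of_real (x ^ n * ?a n)) sums
      complex_of_real ((?a 0 + x * (?a 1 - 3 * k * ?a 0)) / (1 - 3 * k * x + 2 * x\<^sup>2))"
    using sums_two_geometric[OF assms mersenne_lucas_oct_binet[OF clambda_sum_prod, where i = i]]
    by (simp add: clambda_sum_prod)
  then show "(\<lambda>n. ((x ^ n) *s mersenne_lucas_oct k n) $ i) sums
      ((1 / (1 - 3 * k * x + 2 * x\<^sup>2)) *s
        (mersenne_lucas_oct k 0 +
         x *s (mersenne_lucas_oct k 1 - (3 * k) *s mersenne_lucas_oct k 0))) $ i"
    unfolding sums_of_real_iff
    by (simp add: add_divide_distrib diff_divide_distrib right_diff_distrib mult.assoc)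
qed

theorem theorem3p7:
  fixes k :: real
  shows
    "(
      \<comment> \<open>ordinary generating function: formal power series and convergent series\<close>
      oct_fps (mersenne_lucas_oct k) =
        (1 / (1 - fps_const (3 * k) * fps_X + 2 * fps_X\<^sup>2)) *s
          (oct_fps_const (mersenne_lucas_oct k 0) +
           fps_X *s oct_fps_const (mersenne_lucas_oct k 1 - (3 * k) *s mersenne_lucas_oct k 0))
      \<and> (\<forall>x::real. norm (clambda1 k * complex_of_real x) < 1 \<and>
                   norm (clambda2 k * complex_of_real x) < 1 \<longrightarrow>
           (\<lambda>n. (x ^ n) *s mersenne_lucas_oct k n) sums
             ((1 / (1 - 3 * k * x + 2 * x\<^sup>2)) *s
               (mersenne_lucas_oct k 0 +
                x *s (mersenne_lucas_oct k 1 - (3 * k) *s mersenne_lucas_oct k 0))))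
     ) \<and> (
      \<comment> \<open>exponential generating function, real roots\<close>
      9 * k\<^sup>2 \<ge> 8 \<longrightarrow>
        oct_fps (\<lambda>n. (1 / fact n) *s mersenne_lucas_oct k n) =
          fps_exp (lambda1 k) *s oct_fps_const (power_oct (lambda1 k)) +
          fps_exp (lambda2 k) *s oct_fps_const (power_oct (lambda2 k))
        \<and> (\<forall>x::real. (\<lambda>n. (x ^ n / fact n) *s mersenne_lucas_oct k n) sums
             (exp (lambda1 k * x) *s power_oct (lambda1 k) +
              exp (lambda2 k * x) *s power_oct (lambda2 k)))
     ) \<and> (
      \<comment> \<open>exponential generating function, arbitrary roots, in the complexified octonions\<close>
      oct_fps (\<lambda>n. (1 / fact n) *s complexify_oct (mersenne_lucas_oct k n)) =
        fps_exp (clambda1 k) *s oct_fps_const (power_oct (clambda1 k)) +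
        fps_exp (clambda2 k) *s oct_fps_const (power_oct (clambda2 k))
      \<and> (\<forall>x::complex. (\<lambda>n. (x ^ n / fact n) *s complexify_oct (mersenne_lucas_oct k n)) sums
           (exp (clambda1 k * x) *s power_oct (clambda1 k) +
            exp (clambda2 k * x) *s power_oct (clambda2 k)))
     )"
proof (intro conjI allI impI; (elim conjE)?)
  show "oct_fps (mersenne_lucas_oct k) =
      (1 / (1 - fps_const (3 * k) * fps_X + 2 * fps_X\<^sup>2)) *s
        (oct_fps_const (mersenne_lucas_oct k 0) +
         fps_X *s oct_fps_const (mersenne_lucas_oct k 1 - (3 * k) *s mersenne_lucas_oct k 0))"
    by (rule mersenne_lucas_oct_ordinary_fps)
next
  fix x :: real
  assume "norm (clambda1 k * complex_of_real x) < 1" "norm (clambda2 k * complex_of_real x) < 1"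
  then show "(\<lambda>n. (x ^ n) *s mersenne_lucas_oct k n) sums
      ((1 / (1 - 3 * k * x + 2 * x\<^sup>2)) *s
        (mersenne_lucas_oct k 0 +
         x *s (mersenne_lucas_oct k 1 - (3 * k) *s mersenne_lucas_oct k 0)))"
    by (rule mersenne_lucas_oct_ordinary_sums)
next
  assume k: "9 * k\<^sup>2 \<ge> 8"
  have binet: "mersenne_lucas_oct k n $ i =
      lambda1 k ^ n * power_oct (lambda1 k) $ i + lambda2 k ^ n * power_oct (lambda2 k) $ i" for n i
    using mersenne_lucas_oct_binet[of "lambda1 k" "lambda2 k" k n i] lambda_sum_prod[OF k] by simp
  show "oct_fps (\<lambda>n. (1 / fact n) *s mersenne_lucas_oct k n) =
      fps_exp (lambda1 k) *s oct_fps_const (power_oct (lambda1 k)) +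
      fps_exp (lambda2 k) *s oct_fps_const (power_oct (lambda2 k))"
    by (rule oct_exponential_generating_function(1)[OF binet])
  show "(\<lambda>n. (x ^ n / fact n) *s mersenne_lucas_oct k n) sums
      (exp (lambda1 k * x) *s power_oct (lambda1 k) +
       exp (lambda2 k * x) *s power_oct (lambda2 k))" for x :: real
    by (rule oct_exponential_generating_function(2)[OF binet])
next
  have binet: "complexify_oct (mersenne_lucas_oct k n) $ i =
      clambda1 k ^ n * power_oct (clambda1 k) $ i + clambda2 k ^ n * power_oct (clambda2 k) $ i"
    for n i
    using mersenne_lucas_oct_binet[OF clambda_sum_prod, where n = n and i = i]
    by (simp add: complexify_oct_def)
  show "oct_fps (\<lambda>n. (1 / fact n) *s complexify_oct (mersenne_lucas_oct k n)) =
      fps_exp (clambda1 k) *s oct_fps_const (power_oct (clambda1 k)) +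
      fps_exp (clambda2 k) *s oct_fps_const (power_oct (clambda2 k))"
    by (rule oct_exponential_generating_function(1)[OF binet])
  show "(\<lambda>n. (x ^ n / fact n) *s complexify_oct (mersenne_lucas_oct k n)) sums
      (exp (clambda1 k * x) *s power_oct (clambda1 k) +
       exp (clambda2 k * x) *s power_oct (clambda2 k))" for x :: complex
    by (rule oct_exponential_generating_function(2)[OF binet])
qed

end
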